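(* Consider the pulse-coupled oscillator network with delayed excitatory coupling with $N\ge 2$ oscillators, rise function $f$, delay $\tau$ and coupling strength $\varepsilon$ (as defined in the context), and suppose: (A1) the system is started at time $t=0$ with initial states $0<x_i(0)\le 1$ (equivalently, initial phases $0<\varphi_i(0)\le 1$), and there are no firings in $[-\tau,0)$; (A2) $f(2\tau)+N\varepsilon<1$. Then from any initial phases other than $\varphi_1(0)=\cdots=\varphi_N(0)$, the network cannot achieve complete synchronization; that is, if the initial phases are not all equal, then there is no $t_0\ge 0$ such that $\varphi_1(t)=\varphi_2(t)=\cdots=\varphi_N(t)$ for all $t\ge t_0$.
   Context: Model. $f:[0,1]\to[0,1]$ is smooth with $f(0)=0$, $f(1)=1$, $f'>0$, $f''<0$. $\tau>0$ is the transmission delay and $\varepsilon>0$ the coupling strength; (A2) implicitly includes $2\tau\in[0,1]$. There are $N\ge 2$ oscillators with identical dynamics and all-to-all coupling. Oscillator $i$ has a phase $\varphi_i(t)$ and a state $x_i(t)=f(\varphi_i(t))$, for $t\ge 0$. Write $\varphi_i(t^-)$, $\varphi_i(t^+)$ for the left and right limits at $t$. Oscillator $i$ fires at time $t$ iff $\varphi_i(t)=1$; let $T_i=\{t\ge 0:\varphi_i(t)=1\}$. A spike emitted by oscillator $j$ at a firing time $s$ reaches every oscillator $i\ne j$ at time $s+\tau$. Thus the number of spikes reaching oscillator $i$ at time $t$ is the number of $j\neq i$ with $t-\tau\in T_j$ (there are no firings in $[-\tau,0)$, so no spikes arrive in $[0,\tau)$). Given the initial phases $\varphi_i(0)\in(0,1]$,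 the phases evolve by the following rules, with $\varphi_i(t)\in(0,1]$ for all $t\ge 0$. (a) For $t>0$: if $m\ge 0$ spikes reach oscillator $i$ at time $t$, then $\varphi_i(t)=f^{-1}\big(\min[1,f(\varphi_i(t^-))+m\varepsilon]\big)$ (so $\varphi_i(t)=\varphi_i(t^-)$ if $m=0$). (b) If $\varphi_i(t)=1$ then $\varphi_i(t^+)=0$; if $\varphi_i(t)<1$ then $\varphi_i(t^+)=\varphi_i(t)$. (c) If no spikes reach oscillator $i$ in $(t_1,t_2)$ and oscillator $i$ does not fire in $(t_1,t_2)$, then the phase grows with unit speed there: $\varphi_i(t_2^-)=\varphi_i(t_1^+)+(t_2-t_1)$. *)

theory Defs
  imports "HOL-Analysis.Analysis"
begin

text \<open>
  Derivatives are taken within \<open>{0..1}\<close>, so they are one-sided at the end points and the values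
  of \<open>f\<close> outside \<open>{0..1}\<close> are irrelevant. The function \<open>D n\<close> is the \<open>n\<close>-th derivative of \<open>f\<close>;
  on \<open>{0..1}\<close> it is uniquely determined.
\<close>

definition rise_function :: "(real \<Rightarrow> real) \<Rightarrow> bool" where
  "rise_function f \<longleftrightarrow>
     f ` {0..1} \<subseteq> {0..1} \<and> f 0 = 0 \<and> f 1 = 1 \<and>
     (\<exists>D :: nat \<Rightarrow> real \<Rightarrow> real. D 0 = f \<and>
        (\<forall>n. \<forall>x\<in>{0..1}. (D n has_real_derivative D (Suc n) x) (at x within {0..1})) \<and>
        (\<forall>x\<in>{0..1}. D 1 x > 0) \<and> (\<forall>x\<in>{0..1}. D 2 x < 0))"

definition firing_times :: "(real \<Rightarrow> real) \<Rightarrow> real set" where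
  "firing_times \<phi> = {t. t \<ge> 0 \<and> \<phi> t = 1}"

text \<open>
  Firing times are nonnegative by definition, so no spike arrives before time \<open>\<tau>\<close>.
\<close>

definition spike_count :: "nat \<Rightarrow> real \<Rightarrow> (nat \<Rightarrow> real \<Rightarrow> real) \<Rightarrow> nat \<Rightarrow> real \<Rightarrow> nat" where
  "spike_count N \<tau> \<phi> i t = card {j \<in> {1..N}. j \<noteq> i \<and> t - \<tau> \<in> firing_times (\<phi> j)}"

definition left_lim :: "(real \<Rightarrow> real) \<Rightarrow> real \<Rightarrow> real" where
  "left_lim g t = Lim (at_left t) g"

definition right_lim :: "(real \<Rightarrow> real) \<Rightarrow> real \<Rightarrow> real" where
  "right_lim g t = Lim (at_right t) g"

text \<open>
  \<open>\<phi> i t\<close> is the phase of oscillator \<open>i \<in> {1..N}\<close> at time \<open>t \<ge> 0\<close>; nothing is required of \<open>\<phi>\<close>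
  at other arguments. \<open>Lim\<close> is only meaningful for convergent functions, so the existence of the
  one-sided limits is demanded separately.
\<close>

locale pulse_coupled_network =
  fixes N :: nat and f :: "real \<Rightarrow> real" and \<tau> \<epsilon> :: real
    and \<phi> :: "nat \<Rightarrow> real \<Rightarrow> real"
  assumes size: "N \<ge> 2"
    and rise: "rise_function f"
    and delay: "\<tau> > 0"
    and coupling: "\<epsilon> > 0"
    and phase_range: "\<And>i t. i \<in> {1..N} \<Longrightarrow> t \<ge> 0 \<Longrightarrow> \<phi> i t \<in> {0<..1}"
    and left_lim_exists:
      "\<And>i t. i \<in> {1..N} \<Longrightarrow> t > 0 \<Longrightarrow> \<exists>l. (\<phi> i \<longlongrightarrow> l) (at_left t)"
    and right_lim_exists:
      "\<And>i t. i \<in> {1..N} \<Longrightarrow> t \<ge> 0 \<Longrightarrow> \<exists>l. (\<phi> i \<longlongrightarrow> l) (at_right t)"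
    and spikes:
      "\<And>i t. i \<in> {1..N} \<Longrightarrow> t > 0 \<Longrightarrow>
         \<phi> i t = the_inv_into {0..1} f
           (min 1 (f (left_lim (\<phi> i) t) + real (spike_count N \<tau> \<phi> i t) * \<epsilon>))"
    and reset:
      "\<And>i t. i \<in> {1..N} \<Longrightarrow> t \<ge> 0 \<Longrightarrow>
         right_lim (\<phi> i) t = (if \<phi> i t = 1 then 0 else \<phi> i t)"
    and growth:
      "\<And>i t1 t2. i \<in> {1..N} \<Longrightarrow> 0 \<le> t1 \<Longrightarrow> t1 < t2 \<Longrightarrow>
         (\<And>t. t1 < t \<Longrightarrow> t < t2 \<Longrightarrow> spike_count N \<tau> \<phi> i t = 0) \<Longrightarrow>
         (\<And>t. t1 < t \<Longrightarrow> t < t2 \<Longrightarrow> t \<notin> firing_times (\<phi> i)) \<Longrightarrow>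
         left_lim (\<phi> i) t2 = right_lim (\<phi> i) t1 + (t2 - t1)"

definition completely_synchronizes :: "nat \<Rightarrow> (nat \<Rightarrow> real \<Rightarrow> real) \<Rightarrow> bool" where
  "completely_synchronizes N \<phi> \<longleftrightarrow>
     (\<exists>t0\<ge>0. \<forall>t\<ge>t0. \<forall>i\<in>{1..N}. \<forall>j\<in>{1..N}. \<phi> i t = \<phi> j t)"

end

theory Submission imports Defs begin

text \<open>
  The dynamics can be run backwards as far as synchrony is concerned: a network that is synchronous
  on \<open>[T, \<infinity>)\<close> with \<open>T > 0\<close> is synchronous on a slightly larger half-line. Taking the infimum of
  all times from which the network stays synchronous, it must therefore be \<open>0\<close>, so the phases
  were equal from the start (\<open>synchronized_from_start\<close>).

  Weak coupling enters through \<open>not_fires_again\<close>: after a firing, an oscillator stays below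
  threshold for at least \<open>2\<tau>\<close>. Indeed concavity of \<open>f\<close> makes it best to grow first and receive the
  pulses afterwards, so a state that starts at \<open>0\<close>, grows for time at most \<open>2\<tau>\<close> and receives at most
  \<open>N\<close> spikes is at most \<open>f (2\<tau>) + N \<epsilon> < 1\<close>. Consequently a pulse reaching an oscillator within
  \<open>2\<tau>\<close> of its last firing is never truncated by the threshold, and its size can be
  recovered from the jump.

  For the backward step let \<open>T > 0\<close> be such that all phases agree from \<open>T\<close> on. Before \<open>T\<close> there is
  an interval without events in which the phases keep constant differences, so it is enough
  that the left limits at \<open>T\<close> agree (\<open>synchrony_extends_to_left_limits\<close>). If none or all of the
  oscillators fired at \<open>s = T - \<tau>\<close>, then all jumps at \<open>T\<close> have the same size and the claim follows.
  Otherwise some \<open>k\<close> fired at \<open>s\<close> and some \<open>l\<close> did not. The oscillator \<open>l\<close> cannot fire in \<open>(s, T)\<close>: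
  its spike would arrive after \<open>T\<close> and reach \<open>k\<close> but not \<open>l\<close>, destroying the synchrony
  (\<open>firing_in_step_before_synchrony\<close>). So in \<open>(s, T)\<close> both oscillators merely grow and receive
  spikes, with \<open>l\<close> starting strictly ahead. The spikes delivered to them differ only by their
  own ones, and if each state is credited with the oscillator's own delivered spikes, then both
  receive the same spikes and the strict order survives until \<open>T\<close> (\<open>state_order_after_firing\<close>). As
  the credit of \<open>l\<close> is at most that of \<open>k\<close>, the states at \<open>T\<close> are different, a contradiction.
\<close>

section \<open>The rise function\<close>

text \<open>
  The last property is concavity in the form in which it is used: the smaller of two phases
  gains more state when both grow by the same amount. It holds because \<open>f'\<close> is decreasing.
\<close>

lemma rise_function_props:
  assumes "rise_function f"
  shows rise_function_strict_mono: "strict_mono_on {0..1} f"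
    and rise_function_image: "f ` {0..1} = {0..1}"
    and rise_function_increment_antimono:
      "\<And>x y d. 0 \<le> x \<Longrightarrow> x \<le> y \<Longrightarrow> 0 \<le> d \<Longrightarrow> y + d \<le> 1 \<Longrightarrow> f (y + d) - f y \<le> f (x + d) - f x"
proof -
  obtain D where D0: "D 0 = f"
    and D: "\<And>n x. x \<in> {0..1} \<Longrightarrow> (D n has_real_derivative D (Suc n) x) (at x within {0..1})"
    and pos: "\<And>x. x \<in> {0..1} \<Longrightarrow> D 1 x > 0" and neg: "\<And>x. x \<in> {0..1} \<Longrightarrow> D 2 x < 0"
    and sub: "f ` {0..1} \<subseteq> {0..1}" and f0: "f 0 = 0" and f1: "f 1 = 1"
    using assms unfolding rise_function_def by blast
  have cont: "continuous_on {0..1} (D n)" for n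
    by (rule DERIV_continuous_on[OF D])
  have D': "(D n has_real_derivative D (Suc n) x) (at x)" if "0 < x" "x < 1" for n x
    using D[of x n] that at_within_Icc_at[of 0 x 1] by auto
  have cf: "continuous_on {0..1} f"
    using cont[of 0] D0 by simp
  show "strict_mono_on {0..1} f"
  proof (rule strict_mono_onI)
    fix x y :: real assume xy: "x \<in> {0..1}" "y \<in> {0..1}" "x < y"
    show "f x < f y"
    proof (rule DERIV_pos_imp_increasing_open[OF xy(3)])
      fix u assume "x < u" "u < y"
      then show "\<exists>z. DERIV f u :> z \<and> 0 < z"
        using D'[of u 0] pos[of u] D0 xy by auto
    next
      show "continuous_on {x..y} f"
        using continuous_on_subset[OF cf] xy by auto
    qed
  qed
  have "{0..1} \<subseteq> f ` {0..1}"
  proof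
    fix y :: real assume "y \<in> {0..1}"
    then show "y \<in> f ` {0..1}"
      using IVT'[of f 0 y 1] f0 f1 cf by force
  qed
  with sub show "f ` {0..1} = {0..1}" by blast
  have D1: "D 1 y \<le> D 1 x" if "0 \<le> x" "x \<le> y" "y \<le> 1" for x y
  proof (rule DERIV_nonpos_imp_decreasing_open[OF that(2)])
    fix u assume "x < u" "u < y"
    then show "\<exists>z. DERIV (D 1) u :> z \<and> z \<le> 0"
      using D'[of u 1] neg[of u] that by (force simp: numeral_2_eq_2)
  next
    show "continuous_on {x..y} (D 1)"
      using continuous_on_subset[OF cont] that by auto
  qed
  fix x y d :: real assume xyd: "0 \<le> x" "x \<le> y" "0 \<le> d" "y + d \<le> 1"
  show "f (y + d) - f y \<le> f (x + d) - f x"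
  proof (rule DERIV_nonpos_imp_decreasing_open[OF xyd(2), of "\<lambda>u. f (u + d) - f u"])
    fix u assume u: "x < u" "u < y"
    have "DERIV f (u + d) :> D 1 (u + d)" "DERIV f u :> D 1 u"
      using D'[of "u + d" 0] D'[of u 0] D0 u xyd by auto
    then have "DERIV (\<lambda>u. f (u + d) - f u) u :> D 1 (u + d) - D 1 u"
      by (intro DERIV_diff DERIV_shift[THEN iffD1])
    moreover have "D 1 (u + d) - D 1 u \<le> 0"
      using D1[of u "u + d"] u xyd by simp
    ultimately show "\<exists>z. DERIV (\<lambda>u. f (u + d) - f u) u :> z \<and> z \<le> 0" by blast
  next
    have "continuous_on {x..y} (\<lambda>u. f (u + d))"
      by (rule continuous_on_compose2[OF cf]) (use xyd in \<open>auto intro!: continuous_intros\<close>)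
    moreover have "continuous_on {x..y} f"
      by (rule continuous_on_subset[OF cf]) (use xyd in auto)
    ultimately show "continuous_on {x..y} (\<lambda>u. f (u + d) - f u)"
      by (intro continuous_on_diff)
  qed
qed

section \<open>Induction along a real interval\<close>

text \<open>
  Induction along the flow: a property holding just after \<open>s\<close> persists to the right of each
  time at which it holds and passes to a time from its left neighbourhood. It replaces an
  enumeration of the events in the interval.
\<close>

lemma real_interval_induct:
  fixes P :: "real \<Rightarrow> bool"
  assumes "s < b"
    and start: "eventually P (at_right s)"
    and right: "\<And>t. s < t \<Longrightarrow> t < b \<Longrightarrow> P t \<Longrightarrow> eventually P (at_right t)"
    and left: "\<And>t. s < t \<Longrightarrow> t \<le> b \<Longrightarrow> eventually P (at_left t) \<Longrightarrow> P t"
  shows "P b"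
proof (rule ccontr)
  assume nP: "\<not> P b"
  define X where "X = {t. s < t \<and> t \<le> b \<and> \<not> P t}"
  define c where "c = Inf X"
  have bX: "b \<in> X" using nP \<open>s < b\<close> by (simp add: X_def)
  have bdd: "bdd_below X" unfolding X_def by (rule bdd_belowI[of _ s]) auto
  have sc: "s \<le> c" unfolding c_def using bX by (intro cInf_greatest) (auto simp: X_def)
  have cb: "c \<le> b" unfolding c_def using bX bdd by (rule cInf_lower)
  have below: "P t" if "s < t" "t < c" for t
    using that cb cInf_lower[OF _ bdd, of t] unfolding c_def[symmetric] by (force simp: X_def)
  have Pc: "P c" if "s < c"
    by (rule left[OF that cb]) (use that below in \<open>auto simp: eventually_at_left_field\<close>)
  have cb': "c < b"
    using cb Pc nP \<open>s < b\<close> by (cases "c = b") auto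
  have "eventually P (at_right c)"
    using start right[OF _ cb' Pc] sc by (cases "c = s") auto
  then obtain d where d: "d > c" "\<And>t. c < t \<Longrightarrow> t < d \<Longrightarrow> P t"
    by (auto simp: eventually_at_right_field)
  obtain x where "x \<in> X" "x < d"
    using cInf_lessD[of X d] d(1) bX unfolding c_def by blast
  moreover have "c \<le> x" unfolding c_def by (rule cInf_lower[OF \<open>x \<in> X\<close> bdd])
  ultimately show False
    using d(2)[of x] Pc by (cases "x = c") (auto simp: X_def)
qed

section \<open>Local behaviour of the phases\<close>

context pulse_coupled_network
begin

abbreviation fires :: "nat \<Rightarrow> real \<Rightarrow> bool" where
  "fires i t \<equiv> t \<in> firing_times (\<phi> i)"

lemma fires_iff: "t \<ge> 0 \<Longrightarrow> fires i t \<longleftrightarrow> \<phi> i t = 1"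
  by (simp add: firing_times_def)

lemma f_mono: "0 \<le> x \<Longrightarrow> x \<le> y \<Longrightarrow> y \<le> 1 \<Longrightarrow> f x \<le> f y"
  using strict_mono_on_leD[OF rise_function_strict_mono[OF rise], of x y] by auto

lemma f_strict_mono: "0 \<le> x \<Longrightarrow> x < y \<Longrightarrow> y \<le> 1 \<Longrightarrow> f x < f y"
  using strict_mono_onD[OF rise_function_strict_mono[OF rise], of x y] by auto

lemma f_less_iff: "0 \<le> x \<Longrightarrow> x \<le> 1 \<Longrightarrow> 0 \<le> y \<Longrightarrow> y \<le> 1 \<Longrightarrow> f x < f y \<longleftrightarrow> x < y"
  using strict_mono_on_less[OF rise_function_strict_mono[OF rise], of x y] by simp

lemma f_le_iff: "0 \<le> x \<Longrightarrow> x \<le> 1 \<Longrightarrow> 0 \<le> y \<Longrightarrow> y \<le> 1 \<Longrightarrow> f x \<le> f y \<longleftrightarrow> x \<le> y"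
  using strict_mono_on_less_eq[OF rise_function_strict_mono[OF rise], of x y] by simp

lemma f_eq_iff: "0 \<le> x \<Longrightarrow> x \<le> 1 \<Longrightarrow> 0 \<le> y \<Longrightarrow> y \<le> 1 \<Longrightarrow> f x = f y \<longleftrightarrow> x = y"
  using strict_mono_on_eq[OF rise_function_strict_mono[OF rise], of x y] by simp

lemma f_0: "f 0 = 0" and f_1: "f 1 = 1"
  using rise by (auto simp: rise_function_def)

lemma left_lim_tendsto:
  assumes "i \<in> {1..N}" "t > 0"
  shows "(\<phi> i \<longlongrightarrow> left_lim (\<phi> i) t) (at_left t)"
  using left_lim_exists[OF assms] unfolding left_lim_def
  by (metis tendsto_Lim trivial_limit_at_left_real)

lemma right_lim_tendsto:
  assumes "i \<in> {1..N}" "t \<ge> 0"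
  shows "(\<phi> i \<longlongrightarrow> right_lim (\<phi> i) t) (at_right t)"
  using right_lim_exists[OF assms] unfolding right_lim_def
  by (metis tendsto_Lim trivial_limit_at_right_real)

lemma left_lim_range:
  assumes "i \<in> {1..N}" "t > 0"
  shows "0 \<le> left_lim (\<phi> i) t" "left_lim (\<phi> i) t \<le> 1"
proof -
  have ev: "eventually (\<lambda>u. 0 \<le> \<phi> i u \<and> \<phi> i u \<le> 1) (at_left t)"
    unfolding eventually_at_left_field
    using phase_range[OF assms(1)] assms(2) by (intro exI[of _ 0]) (auto intro: less_imp_le)
  show "0 \<le> left_lim (\<phi> i) t"
    by (rule tendsto_lowerbound[OF left_lim_tendsto[OF assms]])
      (use ev in \<open>auto elim: eventually_mono\<close>)
  show "left_lim (\<phi> i) t \<le> 1"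
    by (rule tendsto_upperbound[OF left_lim_tendsto[OF assms]])
      (use ev in \<open>auto elim: eventually_mono\<close>)
qed

lemma state_jump:
  assumes "i \<in> {1..N}" "t > 0"
  shows "f (\<phi> i t) = min 1 (f (left_lim (\<phi> i) t) + real (spike_count N \<tau> \<phi> i t) * \<epsilon>)"
    (is "_ = ?y")
proof -
  have "0 \<le> f (left_lim (\<phi> i) t)"
    using f_mono[of 0] f_0 left_lim_range[OF assms] by simp
  then have "?y \<in> f ` {0..1}"
    using rise_function_image[OF rise] coupling by simp
  then show ?thesis
    unfolding spikes[OF assms]
    by (rule f_the_inv_into_f[OF strict_mono_on_imp_inj_on[OF rise_function_strict_mono[OF rise]]])
qed

lemma state_jump_below_threshold:
  assumes "i \<in> {1..N}" "t > 0" "\<phi> i t < 1"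
  shows "f (\<phi> i t) = f (left_lim (\<phi> i) t) + real (spike_count N \<tau> \<phi> i t) * \<epsilon>"
proof -
  have "f (\<phi> i t) < 1"
    using f_strict_mono[of "\<phi> i t" 1] phase_range[OF assms(1), of t] assms f_1 by auto
  then show ?thesis using state_jump[OF assms(1,2)] by linarith
qed

lemma phase_without_spikes:
  assumes "i \<in> {1..N}" "t > 0" "spike_count N \<tau> \<phi> i t = 0"
  shows "\<phi> i t = left_lim (\<phi> i) t"
proof -
  have "f (left_lim (\<phi> i) t) \<le> 1"
    using f_mono[of "left_lim (\<phi> i) t" 1] left_lim_range[OF assms(1,2)] f_1 by simp
  then have "f (\<phi> i t) = f (left_lim (\<phi> i) t)"
    using state_jump[OF assms(1,2)] assms(3) by simp
  then show ?thesis
    using f_eq_iff left_lim_range[OF assms(1,2)] phase_range[OF assms(1), of t] assms(2) by auto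
qed

text \<open>
  A firing makes the phase drop from \<open>1\<close> to \<open>0\<close>. Near a one-sided limit the phase oscillates
  too little for that, so the existence of one-sided limits alone prevents firing times from
  accumulating.
\<close>

lemma not_fires_if_oscillation_small:
  assumes i: "i \<in> {1..N}" and u: "a < u" "u < b"
    and small: "\<And>w. a < w \<Longrightarrow> w < b \<Longrightarrow> \<bar>\<phi> i w - l\<bar> < 1/4"
  shows "\<not> fires i u"
proof
  assume fire: "fires i u"
  then have u0: "u \<ge> 0" and ph: "\<phi> i u = 1" by (auto simp: firing_times_def)
  have "(\<phi> i \<longlongrightarrow> 0) (at_right u)"
    using right_lim_tendsto[OF i u0] reset[OF i u0] ph by simp
  then have "eventually (\<lambda>w. \<phi> i w < 1/4) (at_right u)"
    by (rule order_tendstoD) simp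
  moreover have "eventually (\<lambda>w. u < w \<and> w < b) (at_right u)"
    using eventually_at_right_real[OF u(2)] by (auto elim: eventually_mono)
  ultimately have "eventually (\<lambda>w. \<phi> i w < 1/4 \<and> u < w \<and> w < b) (at_right u)"
    by eventually_elim simp
  then obtain w where "\<phi> i w < 1/4" "u < w" "w < b"
    using eventually_happens'[OF trivial_limit_at_right_real] by blast
  \<comment> \<open>Both \<open>1\<close> and a value below \<open>1/4\<close> would be within \<open>1/4\<close> of \<open>l\<close>.\<close>
  then show False
    using small[of w] small[of u] u ph by linarith
qed

lemma eventually_not_fires_left:
  assumes i: "i \<in> {1..N}"
  shows "eventually (\<lambda>u. \<not> fires i u) (at_left t)"
proof (cases "t > 0")
  case True
  have "eventually (\<lambda>u. \<bar>\<phi> i u - left_lim (\<phi> i) t\<bar> < 1/4) (at_left t)"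
    using tendstoD[OF left_lim_tendsto[OF i True], of "1/4"] by (simp add: dist_real_def)
  then obtain a where "a < t" "\<And>u. a < u \<Longrightarrow> u < t \<Longrightarrow> \<bar>\<phi> i u - left_lim (\<phi> i) t\<bar> < 1/4"
    by (auto simp: eventually_at_left_field)
  then show ?thesis
    unfolding eventually_at_left_field
    using not_fires_if_oscillation_small[OF i, of a _ t "left_lim (\<phi> i) t"] by blast
next
  case False
  then show ?thesis
    unfolding eventually_at_left_field
    by (intro exI[of _ "t - 1"]) (auto simp: firing_times_def)
qed

lemma eventually_not_fires_right:
  assumes i: "i \<in> {1..N}"
  shows "eventually (\<lambda>u. \<not> fires i u) (at_right t)"
proof (cases "t \<ge> 0")
  case True
  have "eventually (\<lambda>u. \<bar>\<phi> i u - right_lim (\<phi> i) t\<bar> < 1/4) (at_right t)"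
    using tendstoD[OF right_lim_tendsto[OF i True], of "1/4"] by (simp add: dist_real_def)
  then obtain a where "a > t" "\<And>u. t < u \<Longrightarrow> u < a \<Longrightarrow> \<bar>\<phi> i u - right_lim (\<phi> i) t\<bar> < 1/4"
    by (auto simp: eventually_at_right_field)
  then show ?thesis
    unfolding eventually_at_right_field
    using not_fires_if_oscillation_small[OF i, of t _ a "right_lim (\<phi> i) t"] by blast
next
  case False
  then show ?thesis
    unfolding eventually_at_right_field
    by (intro exI[of _ 0]) (auto simp: firing_times_def)
qed

lemma finite_firing_times: "i \<in> {1..N} \<Longrightarrow> finite (firing_times (\<phi> i) \<inter> {a..b})"
  using finite_not_islimpt_in_compact[of "{a..b}" "firing_times (\<phi> i)"]
  by (simp add: islimpt_iff_eventually eventually_at_split eventually_not_fires_left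
      eventually_not_fires_right Int_commute)

lemma finite_firing_times_Ioc: "i \<in> {1..N} \<Longrightarrow> finite (firing_times (\<phi> i) \<inter> {a<..b})"
  by (rule finite_subset[OF _ finite_firing_times[of i a b]]) auto

lemma spike_count_eq_0:
  assumes "\<And>j. j \<in> {1..N} \<Longrightarrow> \<not> fires j (t - \<tau>)"
  shows "spike_count N \<tau> \<phi> i t = 0"
proof -
  have "{j \<in> {1..N}. j \<noteq> i \<and> t - \<tau> \<in> firing_times (\<phi> j)} = {}"
    using assms by auto
  then show ?thesis unfolding spike_count_def by (metis card.empty)
qed

lemma eventually_no_event_left:
  "eventually (\<lambda>u. \<forall>j\<in>{1..N}. \<not> fires j u \<and> \<not> fires j (u - \<tau>)) (at_left t)"
proof (rule eventually_ball_finite[OF finite_atLeastAtMost], intro ballI)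
  fix j assume j: "j \<in> {1..N}"
  obtain a where a: "a < t - \<tau>" "\<And>u. a < u \<Longrightarrow> u < t - \<tau> \<Longrightarrow> \<not> fires j u"
    using eventually_not_fires_left[OF j, of "t - \<tau>"] by (auto simp: eventually_at_left_field)
  have "eventually (\<lambda>u. \<not> fires j (u - \<tau>)) (at_left t)"
    unfolding eventually_at_left_field using a by (intro exI[of _ "a + \<tau>"]) auto
  with eventually_not_fires_left[OF j, of t]
  show "eventually (\<lambda>u. \<not> fires j u \<and> \<not> fires j (u - \<tau>)) (at_left t)"
    by eventually_elim simp
qed

lemma eventually_no_event_right:
  "eventually (\<lambda>u. \<forall>j\<in>{1..N}. \<not> fires j u \<and> \<not> fires j (u - \<tau>)) (at_right t)"
proof (rule eventually_ball_finite[OF finite_atLeastAtMost], intro ballI)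
  fix j assume j: "j \<in> {1..N}"
  obtain a where a: "a > t - \<tau>" "\<And>u. t - \<tau> < u \<Longrightarrow> u < a \<Longrightarrow> \<not> fires j u"
    using eventually_not_fires_right[OF j, of "t - \<tau>"] by (auto simp: eventually_at_right_field)
  have "eventually (\<lambda>u. \<not> fires j (u - \<tau>)) (at_right t)"
    unfolding eventually_at_right_field using a by (intro exI[of _ "a + \<tau>"]) auto
  with eventually_not_fires_right[OF j, of t]
  show "eventually (\<lambda>u. \<not> fires j u \<and> \<not> fires j (u - \<tau>)) (at_right t)"
    by eventually_elim simp
qed

text \<open>
  Events are isolated, so near any time the phase is an affine function of slope \<open>1\<close> on
  either side; all arguments along the flow combine this with the jump rule.
\<close>

lemma eventually_phase_left:
  assumes i: "i \<in> {1..N}" and t: "t > 0"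
  shows "eventually (\<lambda>u. \<phi> i u = left_lim (\<phi> i) t - (t - u)) (at_left t)"
proof -
  obtain a where a: "a < t"
    "\<And>u j. a < u \<Longrightarrow> u < t \<Longrightarrow> j \<in> {1..N} \<Longrightarrow> \<not> fires j u \<and> \<not> fires j (u - \<tau>)"
    using eventually_no_event_left[of t] by (auto simp: eventually_at_left_field)
  have "\<phi> i u = left_lim (\<phi> i) t - (t - u)" if u: "max a 0 < u" "u < t" for u
  proof -
    have "left_lim (\<phi> i) t = right_lim (\<phi> i) u + (t - u)"
      by (rule growth[OF i]) (use u a i in \<open>auto intro!: spike_count_eq_0\<close>)
    moreover have "\<phi> i u \<noteq> 1"
      using a(2)[of u i] i u fires_iff[of u i] by auto
    ultimately show ?thesis using reset[OF i, of u] u by simp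
  qed
  then show ?thesis
    unfolding eventually_at_left_field using a t by (intro exI[of _ "max a 0"]) auto
qed

lemma eventually_phase_right:
  assumes i: "i \<in> {1..N}" and t: "t \<ge> 0"
  shows "eventually (\<lambda>u. \<phi> i u = (if fires i t then 0 else \<phi> i t) + (u - t)) (at_right t)"
proof -
  obtain a where a: "a > t"
    "\<And>u j. t < u \<Longrightarrow> u < a \<Longrightarrow> j \<in> {1..N} \<Longrightarrow> \<not> fires j u \<and> \<not> fires j (u - \<tau>)"
    using eventually_no_event_right[of t] by (auto simp: eventually_at_right_field)
  have "\<phi> i u = (if fires i t then 0 else \<phi> i t) + (u - t)" if u: "t < u" "u < a" for u
  proof -
    have "left_lim (\<phi> i) u = right_lim (\<phi> i) t + (u - t)"
      by (rule growth[OF i]) (use u a i t in \<open>auto intro!: spike_count_eq_0\<close>)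
    moreover have "\<phi> i u = left_lim (\<phi> i) u"
      by (rule phase_without_spikes[OF i]) (use u a i t in \<open>auto intro!: spike_count_eq_0\<close>)
    ultimately show ?thesis using reset[OF i t] fires_iff[OF t] by simp
  qed
  then show ?thesis
    unfolding eventually_at_right_field using a by blast
qed

section \<open>Counting delivered spikes\<close>

text \<open>
  Indexed by the arrival time: the spikes of \<open>j\<close> that arrive in \<open>(s, t]\<close>.
\<close>

definition delivered :: "nat \<Rightarrow> real \<Rightarrow> real \<Rightarrow> nat" where
  "delivered j s t = card (firing_times (\<phi> j) \<inter> {s - \<tau><..t - \<tau>})"

lemma delivered_mono: "j \<in> {1..N} \<Longrightarrow> u \<le> t \<Longrightarrow> delivered j s u \<le> delivered j s t"
  unfolding delivered_def by (intro card_mono finite_firing_times_Ioc) auto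

lemma eventually_delivered_left:
  assumes "s < t"
  shows "eventually (\<lambda>u. \<forall>j\<in>{1..N}. delivered j s t
           = delivered j s u + (if fires j (t - \<tau>) then 1 else 0)) (at_left t)"
proof -
  obtain a where a: "a < t"
    "\<And>u j. a < u \<Longrightarrow> u < t \<Longrightarrow> j \<in> {1..N} \<Longrightarrow> \<not> fires j (u - \<tau>)"
    using eventually_no_event_left[of t] by (auto simp: eventually_at_left_field)
  have "delivered j s t = delivered j s u + (if fires j (t - \<tau>) then 1 else 0)"
    if u: "max a s < u" "u < t" and j: "j \<in> {1..N}" for u j
  proof -
    have nf: "\<not> fires j w" if "u - \<tau> < w" "w < t - \<tau>" for w
      using a(2)[of "w + \<tau>" j] that u j by auto
    have "firing_times (\<phi> j) \<inter> {s - \<tau><..t - \<tau>}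
        = firing_times (\<phi> j) \<inter> {s - \<tau><..u - \<tau>} \<union> (if fires j (t - \<tau>) then {t - \<tau>} else {})"
      (is "?A = ?B")
    proof (rule set_eqI)
      fix w
      show "w \<in> ?A \<longleftrightarrow> w \<in> ?B"
        using nf[of w] u by (cases "w = t - \<tau>"; cases "w \<le> u - \<tau>") auto
    qed
    moreover have "t - \<tau> \<notin> firing_times (\<phi> j) \<inter> {s - \<tau><..u - \<tau>}"
      using u by auto
    ultimately show ?thesis
      unfolding delivered_def using finite_firing_times_Ioc[OF j] by simp
  qed
  then show ?thesis
    unfolding eventually_at_left_field using a assms by (intro exI[of _ "max a s"]) auto
qed

text \<open>
  With its own spike added, every oscillator receives the same number of spikes. This symmetry
  makes different oscillators comparable.
\<close>

lemma spike_count_plus_own: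
  assumes i: "i \<in> {1..N}"
  shows "spike_count N \<tau> \<phi> i t + (if fires i (t - \<tau>) then 1 else 0)
       = card {j \<in> {1..N}. fires j (t - \<tau>)}"
proof -
  let ?A = "{j \<in> {1..N}. j \<noteq> i \<and> t - \<tau> \<in> firing_times (\<phi> j)}"
  have "{j \<in> {1..N}. fires j (t - \<tau>)} = ?A \<union> (if fires i (t - \<tau>) then {i} else {})"
    using i by auto
  then show ?thesis
    unfolding spike_count_def by simp
qed

section \<open>An upper bound on the state after a firing\<close>

text \<open>
  By concavity a pulse raises the state most if it comes last: growing from a higher phase
  gains less. Hence the final state is at most what growth from \<open>0\<close> and the
  pulses contribute separately. All spikes are counted, including those of \<open>i\<close>, which keeps the
  bound symmetric in the oscillators.
\<close>

lemma state_bound_after_firing: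
  assumes i: "i \<in> {1..N}" and s: "fires i s" and b: "s < b" "b \<le> s + 1"
    and quiet: "\<And>u. s < u \<Longrightarrow> u < b \<Longrightarrow> \<not> fires i u"
  shows "f (\<phi> i b) \<le> f (b - s) + real (\<Sum>j\<in>{1..N}. delivered j s b) * \<epsilon>"
proof -
  define B where "B = (\<lambda>t. \<Sum>j\<in>{1..N}. delivered j s t)"
  \<comment> \<open>The lower bound on the phase is what allows comparing its growth with that of \<open>t - s\<close>.\<close>
  define P where "P = (\<lambda>t. t - s \<le> \<phi> i t \<and> f (\<phi> i t) \<le> f (t - s) + real (B t) * \<epsilon>)"
  have s0: "s \<ge> 0" using s by (simp add: firing_times_def)
  have "P b"
  proof (rule real_interval_induct[OF b(1)])
    show "eventually P (at_right s)"
      using eventually_phase_right[OF i s0]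
      by eventually_elim (use s coupling in \<open>simp add: P_def\<close>)
  next
    fix t assume t: "s < t" "t < b" "P t"
    have ev: "eventually (\<lambda>u. t < u \<and> u < b) (at_right t)"
      using eventually_at_right_real[OF t(2)] by (auto elim: eventually_mono)
    have t0: "t \<ge> 0" using s0 t by simp
    show "eventually P (at_right t)"
      using eventually_phase_right[OF i t0] ev
    proof eventually_elim
      case (elim u)
      then have ph: "\<phi> i u = \<phi> i t + (u - t)" using quiet t by simp
      have "f (\<phi> i t + (u - t)) - f (\<phi> i t) \<le> f (t - s + (u - t)) - f (t - s)"
        using t elim ph phase_range[OF i, of u] t0
        by (intro rise_function_increment_antimono[OF rise]) (auto simp: P_def)
      moreover have "real (B t) * \<epsilon> \<le> real (B u) * \<epsilon>"
        unfolding B_def using coupling elim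
        by (intro mult_right_mono of_nat_mono sum_mono delivered_mono) auto
      ultimately show ?case
        using t ph by (simp add: P_def)
    qed
  next
    fix t assume t: "s < t" "t \<le> b" and ev: "eventually P (at_left t)"
    have t0: "t > 0" using t s0 by simp
    let ?L = "left_lim (\<phi> i) t" and ?G = "card {j \<in> {1..N}. fires j (t - \<tau>)}"
    have "eventually (\<lambda>u. s < u \<and> u < t) (at_left t)"
      using eventually_at_left_real[OF t(1)] by (auto elim: eventually_mono)
    with ev eventually_phase_left[OF i t0] eventually_delivered_left[OF t(1)]
    have "eventually (\<lambda>u. P u \<and> \<phi> i u = ?L - (t - u) \<and> B t = B u + ?G \<and> s < u \<and> u < t) (at_left t)"
    proof eventually_elim
      case (elim u)
      then have "B t = B u + (\<Sum>j\<in>{1..N}. if fires j (t - \<tau>) then 1 else 0)"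
        unfolding B_def by (simp add: sum.distrib)
      also have "(\<Sum>j\<in>{1..N}. if fires j (t - \<tau>) then 1 else 0) = ?G"
        by (simp add: sum.If_cases Int_def)
      finally show ?case using elim by simp
    qed
    then obtain u where u: "P u" "\<phi> i u = ?L - (t - u)" "B t = B u + ?G" "s < u" "u < t"
      using eventually_happens'[OF trivial_limit_at_left_real] by blast
    note L = left_lim_range[OF i t0]
    have "f (\<phi> i u + (t - u)) - f (\<phi> i u) \<le> f (u - s + (t - u)) - f (u - s)"
      using u L by (intro rise_function_increment_antimono[OF rise]) (auto simp: P_def)
    then have 1: "f ?L \<le> f (t - s) + real (B u) * \<epsilon>" and 2: "t - s \<le> ?L"
      using u by (auto simp: P_def)
    have sc: "real (spike_count N \<tau> \<phi> i t) * \<epsilon> \<le> real ?G * \<epsilon>"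
      using spike_count_plus_own[OF i, of t] coupling by (intro mult_right_mono) auto
    have "f (\<phi> i t) \<le> f ?L + real ?G * \<epsilon>"
      using state_jump[OF i t0] sc by linarith
    moreover have "f ?L \<le> f (\<phi> i t)"
      using state_jump[OF i t0] f_mono[of ?L 1] L f_1 coupling by simp
    then have "?L \<le> \<phi> i t"
      using f_le_iff L phase_range[OF i, of t] t0 by auto
    ultimately show "P t"
      using 1 2 u(3) by (simp add: P_def algebra_simps)
  qed
  then show ?thesis by (simp add: P_def B_def)
qed

section \<open>Comparing two oscillators\<close>

text \<open>
  If \<open>x\<close> is ahead of \<open>y\<close>, it gains less by concavity; if not, the order of the phases persists
  and \<open>e\<close> only helps.
\<close>

lemma growth_preserves_state_order:
  assumes "0 \<le> x" "0 \<le> y" "0 \<le> d" "x + d \<le> 1" "y + d \<le> 1" "0 \<le> e" "f x < f y + e"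
  shows "f (x + d) < f (y + d) + e"
proof (cases "x \<le> y")
  case True
  show ?thesis
  proof (cases "e = 0")
    case True
    with assms have "x < y" using f_less_iff by auto
    then show ?thesis using True f_strict_mono[of "x + d" "y + d"] assms by simp
  next
    case False
    then show ?thesis using f_mono[of "x + d" "y + d"] \<open>x \<le> y\<close> assms by simp
  qed
next
  case False
  then have "f (x + d) - f x \<le> f (y + d) - f y"
    using assms by (intro rise_function_increment_antimono[OF rise]) auto
  with assms show ?thesis by simp
qed

text \<open>
  After the reset \<open>i\<close> is at \<open>0\<close> and \<open>j\<close> strictly above. Each state is credited with the
  oscillator's own delivered spikes; then by \<open>spike_count_plus_own\<close> every arrival raises both sides
  by the same amount. Growth preserves the order as long as \<open>i\<close> has no credit, which
  is the reason for the assumption that no spike of \<open>i\<close> is delivered before \<open>b\<close>. A spike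
  delivered at \<open>b\<close> itself is allowed: that is the case needed for the comparison at \<open>T = s + \<tau>\<close>.
\<close>

lemma state_order_after_firing:
  assumes i: "i \<in> {1..N}" and j: "j \<in> {1..N}"
    and s: "fires i s" "\<not> fires j s" and b: "s < b"
    and quiet_i: "\<And>u. s < u \<Longrightarrow> u < b \<Longrightarrow> \<not> fires i u"
    and quiet_j: "\<And>u. s < u \<Longrightarrow> u \<le> b \<Longrightarrow> \<not> fires j u"
    and no_delivery: "\<And>u. s - \<tau> < u \<Longrightarrow> u < b - \<tau> \<Longrightarrow> \<not> fires i u"
  shows "f (\<phi> i b) + real (delivered i s b) * \<epsilon> < f (\<phi> j b) + real (delivered j s b) * \<epsilon>"
proof -
  define P where "P = (\<lambda>t. f (\<phi> i t) + real (delivered i s t) * \<epsilon>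
                          < f (\<phi> j t) + real (delivered j s t) * \<epsilon>)"
  have s0: "s \<ge> 0" using s by (simp add: firing_times_def)
  have di: "delivered i s u = 0" if "u < b" for u
  proof -
    have "firing_times (\<phi> i) \<inter> {s - \<tau><..u - \<tau>} = {}"
      using no_delivery that by auto
    then show ?thesis by (simp add: delivered_def)
  qed
  have "P b"
  proof (rule real_interval_induct[OF b])
    have ev: "eventually (\<lambda>u. s < u \<and> u < b) (at_right s)"
      using eventually_at_right_real[OF b] by (auto elim: eventually_mono)
    show "eventually P (at_right s)"
      using eventually_phase_right[OF i s0] eventually_phase_right[OF j s0] ev
    proof eventually_elim
      case (elim u)
      then have "\<phi> i u = u - s" "\<phi> j u = \<phi> j s + (u - s)" using s by auto
      then have "f (\<phi> i u) < f (\<phi> j u)"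
        using phase_range[OF j, of s] phase_range[OF j, of u] s0 elim by (intro f_strict_mono) auto
      moreover have "real (delivered i s u) * \<epsilon> = 0" using di[of u] elim by simp
      moreover have "0 \<le> real (delivered j s u) * \<epsilon>" using coupling by simp
      ultimately show ?case unfolding P_def by linarith
    qed
  next
    fix t assume t: "s < t" "t < b" "P t"
    have ev: "eventually (\<lambda>u. t < u \<and> u < b) (at_right t)"
      using eventually_at_right_real[OF t(2)] by (auto elim: eventually_mono)
    have t0: "t \<ge> 0" using s0 t by simp
    show "eventually P (at_right t)"
      using eventually_phase_right[OF i t0] eventually_phase_right[OF j t0] ev
    proof eventually_elim
      case (elim u)
      then have ph: "\<phi> i u = \<phi> i t + (u - t)" "\<phi> j u = \<phi> j t + (u - t)"
        using quiet_i quiet_j t by auto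
      have "f (\<phi> i t + (u - t)) < f (\<phi> j t + (u - t)) + real (delivered j s t) * \<epsilon>"
        using t elim ph phase_range[OF i, of u] phase_range[OF j, of u]
          phase_range[OF i, of t] phase_range[OF j, of t] t0 coupling di[of t]
        by (intro growth_preserves_state_order) (auto simp: P_def)
      moreover have "real (delivered j s t) * \<epsilon> \<le> real (delivered j s u) * \<epsilon>"
        using coupling elim j by (intro mult_right_mono of_nat_mono delivered_mono) auto
      ultimately show ?case
        using ph di[of u] elim by (simp add: P_def)
    qed
  next
    fix t assume t: "s < t" "t \<le> b" and ev: "eventually P (at_left t)"
    have t0: "t > 0" using t s0 by simp
    let ?L = "\<lambda>k. left_lim (\<phi> k) t" and ?G = "card {k \<in> {1..N}. fires k (t - \<tau>)}"
    let ?o = "\<lambda>k. if fires k (t - \<tau>) then 1 else 0 :: nat"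
    have "eventually (\<lambda>u. s < u \<and> u < t) (at_left t)"
      using eventually_at_left_real[OF t(1)] by (auto elim: eventually_mono)
    with ev eventually_phase_left[OF i t0] eventually_phase_left[OF j t0]
      eventually_delivered_left[OF t(1)]
    have "eventually (\<lambda>u. P u \<and> \<phi> i u = ?L i - (t - u) \<and> \<phi> j u = ?L j - (t - u)
        \<and> delivered i s t = delivered i s u + ?o i
        \<and> delivered j s t = delivered j s u + ?o j \<and> s < u \<and> u < t) (at_left t)"
      by eventually_elim (use i j in blast)
    then obtain u where u: "P u" "\<phi> i u = ?L i - (t - u)" "\<phi> j u = ?L j - (t - u)"
      "delivered i s t = delivered i s u + ?o i"
      "delivered j s t = delivered j s u + ?o j" "s < u" "u < t"
      using eventually_happens'[OF trivial_limit_at_left_real] by blast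
    have "f (\<phi> i u + (t - u)) < f (\<phi> j u + (t - u)) + real (delivered j s u) * \<epsilon>"
      using u t left_lim_range[OF i t0] left_lim_range[OF j t0]
        phase_range[OF i, of u] phase_range[OF j, of u] s0 coupling di[of u]
      by (intro growth_preserves_state_order) (auto simp: P_def)
    then have lim: "f (?L i) < f (?L j) + real (delivered j s u) * \<epsilon>"
      using u by simp
    \<comment> \<open>The larger state is not truncated by the threshold; truncating the smaller one does no harm.\<close>
    have "\<phi> j t < 1"
      using quiet_j[OF t] fires_iff[of t j] t0 phase_range[OF j, of t] by auto
    then have jj: "f (\<phi> j t) = f (?L j) + real (spike_count N \<tau> \<phi> j t) * \<epsilon>"
      by (rule state_jump_below_threshold[OF j t0])
    have ji: "f (\<phi> i t) \<le> f (?L i) + real (spike_count N \<tau> \<phi> i t) * \<epsilon>"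
      using state_jump[OF i t0] by simp
    have sc: "real (spike_count N \<tau> \<phi> k t) * \<epsilon> + real (?o k) * \<epsilon> = real ?G * \<epsilon>"
      if "k \<in> {1..N}" for k
      using spike_count_plus_own[OF that, of t] by (metis distrib_right of_nat_add)
    have dl: "real (delivered i s t) * \<epsilon> = real (?o i) * \<epsilon>"
      "real (delivered j s t) * \<epsilon> = real (delivered j s u) * \<epsilon> + real (?o j) * \<epsilon>"
      using u(4,5) di[of u] u(7) t by (auto simp: distrib_right)
    show "P t"
      unfolding P_def using lim jj ji sc[OF i] sc[OF j] dl by linarith
  qed
  then show ?thesis by (simp add: P_def)
qed

end

section \<open>Weak coupling\<close>

locale weakly_coupled_network = pulse_coupled_network +
  assumes delay_le: "2 * \<tau> \<le> 1"
    and weak: "f (2 * \<tau>) + real N * \<epsilon> < 1"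
begin

text \<open>
  Among all second firings within \<open>2\<tau>\<close> take the earliest, at \<open>r\<close> by oscillator \<open>k\<close>, whose previous
  firing is at \<open>q\<close>. The spikes arriving in \<open>(q, r]\<close> were emitted before \<open>r\<close> within a window
  of length at most \<open>2\<tau>\<close>, so by minimality each oscillator contributes at most one. The state
  bound then keeps \<open>k\<close> below threshold at \<open>r\<close>.
\<close>

lemma not_fires_again:
  assumes "i \<in> {1..N}" "fires i s" "s < t" "t \<le> s + 2 * \<tau>"
  shows "\<not> fires i t"
proof
  assume "fires i t"
  define V where "V = {t'. t' \<le> t \<and> (\<exists>k\<in>{1..N}. \<exists>s'. fires k s' \<and> s' < t' \<and> t' \<le> s' + 2 * \<tau> \<and> fires k t')}"
  have "V \<subseteq> (\<Union>k\<in>{1..N}. firing_times (\<phi> k) \<inter> {0..t})"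
    by (auto simp: V_def firing_times_def)
  then have fin: "finite V"
    by (rule finite_subset) (intro finite_UN_I finite_atLeastAtMost finite_firing_times)
  have "t \<in> V" using assms \<open>fires i t\<close> by (auto simp: V_def)
  define r where "r = Min V"
  have "r \<in> V" using fin \<open>t \<in> V\<close> unfolding r_def by (intro Min_in) auto
  then obtain k q where k: "k \<in> {1..N}" "fires k q" "q < r" "r \<le> q + 2 * \<tau>" "fires k r" and rt: "r \<le> t"
    by (auto simp: V_def)
  have earliest: "\<not> (fires l p \<and> p < p' \<and> p' \<le> p + 2 * \<tau> \<and> fires l p')"
    if "p' < r" "l \<in> {1..N}" for l p p'
  proof
    assume "fires l p \<and> p < p' \<and> p' \<le> p + 2 * \<tau> \<and> fires l p'"
    then have "p' \<in> V" using that rt by (auto simp: V_def)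
    then show False using Min_le[OF fin] that(1) unfolding r_def by force
  qed
  have quiet: "\<not> fires k u" if "q < u" "u < r" for u
    using earliest[of u k q] k that by auto
  have once: "delivered l q r \<le> 1" if l: "l \<in> {1..N}" for l
  proof -
    have "p = p'" if "fires l p" "fires l p'" "q - \<tau> < p" "p \<le> r - \<tau>" "q - \<tau> < p'" "p' \<le> r - \<tau>" for p p'
      using earliest[of p l p'] earliest[of p' l p] that l k delay by (cases p p' rule: linorder_cases) auto
    then show ?thesis
      unfolding delivered_def One_nat_def card_le_Suc0_iff_eq[OF finite_firing_times_Ioc[OF l]] by simp
  qed
  have "(\<Sum>l\<in>{1..N}. delivered l q r) \<le> N"
    using sum_mono[of "{1..N}" "\<lambda>l. delivered l q r" "\<lambda>_. 1"] once by simp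
  then have "real (\<Sum>l\<in>{1..N}. delivered l q r) * \<epsilon> \<le> real N * \<epsilon>"
    using coupling by (intro mult_right_mono of_nat_mono) auto
  moreover have "f (\<phi> k r) \<le> f (r - q) + real (\<Sum>l\<in>{1..N}. delivered l q r) * \<epsilon>"
    by (rule state_bound_after_firing) (use k quiet delay_le in auto)
  moreover have "f (r - q) \<le> f (2 * \<tau>)"
    using k delay_le by (intro f_mono) auto
  moreover have "\<phi> k r = 1" using k(5) by (simp add: firing_times_def)
  ultimately show False using weak f_1 by simp
qed

lemma phase_less_1_after_firing:
  assumes "i \<in> {1..N}" "fires i s" "s < t" "t \<le> s + 2 * \<tau>"
  shows "\<phi> i t < 1"
proof -
  have "t \<ge> 0" using assms by (simp add: firing_times_def)
  then show ?thesis
    using not_fires_again[OF assms] fires_iff[of t i] phase_range[OF assms(1), of t] by auto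
qed

lemma delivered_le_1:
  assumes i: "i \<in> {1..N}"
  shows "delivered i s (s + \<tau>) \<le> 1"
proof -
  have "p = p'" if "fires i p" "fires i p'" "s - \<tau> < p" "p \<le> s" "s - \<tau> < p'" "p' \<le> s" for p p'
    using not_fires_again[OF i, of p p'] not_fires_again[OF i, of p' p] that delay
    by (cases p p' rule: linorder_cases) auto
  then show ?thesis
    unfolding delivered_def One_nat_def card_le_Suc0_iff_eq[OF finite_firing_times_Ioc[OF i]] by simp
qed

text \<open>
  The spike of \<open>j\<close> arrives when \<open>i\<close> and \<open>j\<close> are already in step and stay so. As \<open>j\<close> fired only \<open>\<tau>\<close>
  before, its jump is not truncated, so both jumps have the same size. But \<open>j\<close> does not receive its
  own spike, so \<open>i\<close> must have fired at the same time.
\<close>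

lemma firing_in_step_before_synchrony:
  assumes i: "i \<in> {1..N}" and j: "j \<in> {1..N}"
    and sync: "\<And>t. t \<ge> T \<Longrightarrow> \<phi> i t = \<phi> j t"
    and v: "fires j v" "T < v + \<tau>"
  shows "fires i v"
proof (rule ccontr)
  assume ni: "\<not> fires i v"
  define w where "w = v + \<tau>"
  have w: "w > 0" "T < w" using v delay by (auto simp: w_def firing_times_def)
  have "eventually (\<lambda>u. u \<in> {T<..<w}) (at_left w)"
    by (rule eventually_at_left_real[OF w(2)])
  then have ev: "eventually (\<lambda>u. \<phi> i u = \<phi> j u) (at_left w)"
    by eventually_elim (use sync in auto)
  have "(\<phi> j \<longlongrightarrow> left_lim (\<phi> i) w) (at_left w)"
    using left_lim_tendsto[OF i w(1)] tendsto_cong[OF ev] by simp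
  with left_lim_tendsto[OF j w(1)] have L: "left_lim (\<phi> i) w = left_lim (\<phi> j) w"
    by (meson tendsto_unique trivial_limit_at_left_real)
  have "\<phi> j w < 1"
    using phase_less_1_after_firing[OF j v(1), of w] delay by (simp add: w_def)
  moreover have "\<phi> i w = \<phi> j w" using sync w by simp
  ultimately have "spike_count N \<tau> \<phi> i w = spike_count N \<tau> \<phi> j w"
    using state_jump_below_threshold[OF i w(1)] state_jump_below_threshold[OF j w(1)] L coupling
    by auto
  moreover have "\<not> fires i (w - \<tau>)" "fires j (w - \<tau>)"
    using ni v by (auto simp: w_def)
  ultimately show False
    using spike_count_plus_own[OF i, of w] spike_count_plus_own[OF j, of w] by simp
qed

text \<open>
  The case distinction is on who fired at \<open>T - \<tau>\<close>. Equal jumps force equal left limits, and unequal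
  jumps are impossible: they would need an oscillator \<open>l\<close> that was ahead of \<open>k\<close> just after
  \<open>T - \<tau>\<close> to be behind it just before \<open>T\<close> by exactly one pulse, which the comparison of credited
  states excludes.
\<close>

lemma synchrony_extends_to_left_limits:
  assumes T: "T > 0" and sync: "\<And>t i j. t \<ge> T \<Longrightarrow> i \<in> {1..N} \<Longrightarrow> j \<in> {1..N} \<Longrightarrow> \<phi> i t = \<phi> j t"
    and i: "i \<in> {1..N}" and j: "j \<in> {1..N}"
  shows "left_lim (\<phi> i) T = left_lim (\<phi> j) T"
proof -
  consider (none) "\<And>k. k \<in> {1..N} \<Longrightarrow> \<not> fires k (T - \<tau>)"
    | (all) "\<And>l. l \<in> {1..N} \<Longrightarrow> fires l (T - \<tau>)"
    | (some) k l where "k \<in> {1..N}" "fires k (T - \<tau>)" "l \<in> {1..N}" "\<not> fires l (T - \<tau>)"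
    by blast
  then show ?thesis
  proof cases
    case none
    then show ?thesis
      using phase_without_spikes[OF i T] phase_without_spikes[OF j T] spike_count_eq_0 sync[of T i j] i j
      by simp
  next
    case all
    have lt: "\<phi> m T < 1" if "m \<in> {1..N}" for m
      using phase_less_1_after_firing[OF that all[OF that], of T] delay by simp
    have "spike_count N \<tau> \<phi> i T = spike_count N \<tau> \<phi> j T"
      using spike_count_plus_own[OF i, of T] spike_count_plus_own[OF j, of T] all i j by simp
    then have "f (left_lim (\<phi> i) T) = f (left_lim (\<phi> j) T)"
      using state_jump_below_threshold[OF i T lt[OF i]] state_jump_below_threshold[OF j T lt[OF j]]
        sync[of T i j] i j by simp
    then show ?thesis
      using f_eq_iff left_lim_range[OF i T] left_lim_range[OF j T] by simp
  next
    case some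
    define s where "s = T - \<tau>"
    note k = some(1) and l = some(3)
    have ks: "fires k s" and ls: "\<not> fires l s" using some by (auto simp: s_def)
    have s: "s < T" "T = s + \<tau>" using delay by (auto simp: s_def)
    have quiet_k: "\<not> fires k u" if "s < u" "u \<le> T" for u
      using not_fires_again[OF k ks, of u] that s delay by simp
    have quiet_l: "\<not> fires l u" if u: "s < u" "u \<le> T" for u
    proof
      assume "fires l u"
      have "fires k u"
      proof (rule firing_in_step_before_synchrony[OF k l])
        show "\<phi> k t = \<phi> l t" if "t \<ge> T" for t by (rule sync[OF that k l])
      qed (use \<open>fires l u\<close> u s in simp_all)
      with quiet_k[OF u] show False by simp
    qed
    have "\<not> fires k u" if "s - \<tau> < u" "u < T - \<tau>" for u
      using not_fires_again[OF k, of u s] ks that s delay by auto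
    then have lt: "f (\<phi> k T) + real (delivered k s T) * \<epsilon> < f (\<phi> l T) + real (delivered l s T) * \<epsilon>"
      using quiet_k quiet_l s by (intro state_order_after_firing[OF k l ks ls]) auto
    have "s \<in> firing_times (\<phi> k) \<inter> {s - \<tau><..s}"
      using ks delay by simp
    then have "delivered k s T \<ge> 1"
      unfolding delivered_def s(2) One_nat_def Suc_le_eq
      using finite_firing_times_Ioc[OF k, of "s - \<tau>" s] by (subst card_gt_0_iff) auto
    then have "delivered l s T \<le> delivered k s T"
      using delivered_le_1[OF l, of s] s(2) by simp
    then have "real (delivered l s T) * \<epsilon> \<le> real (delivered k s T) * \<epsilon>"
      using coupling by (intro mult_right_mono) auto
    with lt sync[of T k l] k l have False by simp
    then show ?thesis ..
  qed
qed

lemma synchrony_extends_backwards: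
  assumes T: "T > 0" and sync: "\<And>t i j. t \<ge> T \<Longrightarrow> i \<in> {1..N} \<Longrightarrow> j \<in> {1..N} \<Longrightarrow> \<phi> i t = \<phi> j t"
  shows "eventually (\<lambda>t. \<forall>i\<in>{1..N}. \<forall>j\<in>{1..N}. \<phi> i t = \<phi> j t) (at_left T)"
proof (intro eventually_ball_finite ballI finite_atLeastAtMost)
  fix i j assume i: "i \<in> {1..N}" and j: "j \<in> {1..N}"
  show "eventually (\<lambda>t. \<phi> i t = \<phi> j t) (at_left T)"
    using eventually_phase_left[OF i T] eventually_phase_left[OF j T]
    by eventually_elim (use synchrony_extends_to_left_limits[OF T sync i j] in simp)
qed

text \<open>
  Equal right limits determine the phase, since a reset oscillator has right limit \<open>0\<close> and all
  others have a positive one.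
\<close>

lemma synchrony_closed:
  assumes T: "T \<ge> 0" and i: "i \<in> {1..N}" and j: "j \<in> {1..N}"
    and sync: "\<And>t. t > T \<Longrightarrow> \<phi> i t = \<phi> j t"
  shows "\<phi> i T = \<phi> j T"
proof -
  have "eventually (\<lambda>t. \<phi> i t = \<phi> j t) (at_right T)"
    unfolding eventually_at_right_field using sync by (intro exI[of _ "T + 1"]) auto
  from tendsto_cong[OF this] have "(\<phi> j \<longlongrightarrow> right_lim (\<phi> i) T) (at_right T)"
    using right_lim_tendsto[OF i T] by simp
  with right_lim_tendsto[OF j T] have "right_lim (\<phi> i) T = right_lim (\<phi> j) T"
    by (meson tendsto_unique trivial_limit_at_right_real)
  then show ?thesis
    using reset[OF i T] reset[OF j T] phase_range[OF i T] phase_range[OF j T]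
    by (auto split: if_splits)
qed

lemma synchronized_from_start:
  assumes "completely_synchronizes N \<phi>" and i: "i \<in> {1..N}" and j: "j \<in> {1..N}"
  shows "\<phi> i 0 = \<phi> j 0"
proof -
  define S where "S = {t0. t0 \<ge> 0 \<and> (\<forall>t\<ge>t0. \<forall>i\<in>{1..N}. \<forall>j\<in>{1..N}. \<phi> i t = \<phi> j t)}"
  define T where "T = Inf S"
  have ne: "S \<noteq> {}" using assms(1) by (auto simp: S_def completely_synchronizes_def)
  have bdd: "bdd_below S" by (rule bdd_belowI[of _ 0]) (simp add: S_def)
  have T0: "T \<ge> 0" unfolding T_def using ne by (intro cInf_greatest) (auto simp: S_def)
  have after: "\<phi> i t = \<phi> j t" if t: "t > T" "i \<in> {1..N}" "j \<in> {1..N}" for t i j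
  proof -
    obtain t0 where "t0 \<in> S" "t0 < t"
      using cInf_lessD[OF ne, of t] t(1) unfolding T_def by blast
    then have "\<forall>i\<in>{1..N}. \<forall>j\<in>{1..N}. \<phi> i t = \<phi> j t"
      unfolding S_def using less_imp_le by blast
    with t(2,3) show ?thesis by blast
  qed
  have sync: "\<phi> i t = \<phi> j t" if "t \<ge> T" "i \<in> {1..N}" "j \<in> {1..N}" for t i j
  proof (cases "t = T")
    case True
    then show ?thesis using synchrony_closed[OF T0 that(2,3) after[OF _ that(2,3)]] by simp
  next
    case False
    then show ?thesis using after[OF _ that(2,3)] that(1) by simp
  qed
  have "\<not> T > 0"
  proof
    assume "T > 0"
    obtain a where a: "a < T" "\<And>t i j. a < t \<Longrightarrow> t < T \<Longrightarrow> i \<in> {1..N} \<Longrightarrow> j \<in> {1..N} \<Longrightarrow> \<phi> i t = \<phi> j t"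
      using synchrony_extends_backwards[OF \<open>T > 0\<close> sync]
      unfolding eventually_at_left_field by blast
    obtain t0 where t0: "max a 0 < t0" "t0 < T"
      using dense[of "max a 0" T] a \<open>T > 0\<close> by auto
    have "\<phi> i t = \<phi> j t" if "t \<ge> t0" "i \<in> {1..N}" "j \<in> {1..N}" for t i j
      using a(2)[of t i j] sync[of t i j] that t0 by (cases "t < T") auto
    moreover have "t0 \<ge> 0" using t0 by simp
    ultimately have "t0 \<in> S" unfolding S_def by blast
    then show False using cInf_lower[OF _ bdd] t0 unfolding T_def by force
  qed
  then show ?thesis using sync[of 0 i j] T0 i j by simp
qed

end

theorem theorem1:
  fixes N :: nat and f :: "real \<Rightarrow> real" and \<tau> \<epsilon> :: real
    and \<phi> :: "nat \<Rightarrow> real \<Rightarrow> real"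
  assumes network: "pulse_coupled_network N f \<tau> \<epsilon> \<phi>"
    and A1: "\<forall>i\<in>{1..N}. 0 < \<phi> i 0 \<and> \<phi> i 0 \<le> 1"
    and A2: "2 * \<tau> \<in> {0..1}" "f (2 * \<tau>) + real N * \<epsilon> < 1"
    and not_all_equal: "\<exists>i\<in>{1..N}. \<exists>j\<in>{1..N}. \<phi> i 0 \<noteq> \<phi> j 0"
  shows "\<not> completely_synchronizes N \<phi>"
proof -
  interpret weakly_coupled_network N f \<tau> \<epsilon> \<phi>
    using network A2 by (simp add: weakly_coupled_network_def weakly_coupled_network_axioms_def)
  show ?thesis using synchronized_from_start not_all_equal by blast
qed

end
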